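(* Consider the quadratic program $$\text{minimize}_{\eta}\ \tfrac12\eta^TQ\eta\quad\text{subject to}\quad A\eta=0,$$ where $Q\in\mathbb R^{p\times p}$ is symmetric and $A\in\mathbb R^{q\times p}$ has full row rank. Then the projected gradient descent (PGD) updates $$\eta^{(t+1)}=(I-A^T(AA^T)^{-1}A)(I-\alpha Q)\eta^{(t)}$$ with learning rate $\alpha<1/\lambda_{\max}(Q)$ converge to a solution or diverge to infinity exponentially fast. Moreover, with random initialization, PGD correctly checks the conditions (T1)–(T3) with probability $1$.
   Context: $\lambda_{\max}(Q)$ is the largest eigenvalue of $Q$. With $\mathcal S=\{\eta\in\mathbb R^p:A\eta=0\}$ the feasible set of the quadratic program, the three disjoint termination conditions are: (T1) $\eta^TQ\eta>0$ whenever $\eta\in\mathcal S$, $\eta\ne0$; (T2) $\eta^TQ\eta\ge0$ whenever $\eta\in\mathcal S$, but there exists $\eta\neq0$, $\eta\in\mathcal S$, such that $\eta^TQ\eta=0$; (T3) there exists $\eta$ such that $\eta\in\mathcal S$ and $\eta^TQ\eta<0$.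
   Formalization: The learning rate is taken positive (arbitrary if λ_max(Q) ≤ 0); if no minimizer exists, exceptional starts such as η=0 can converge to a non-minimizer, so convergence to a solution or divergence is claimed almost surely, and for every start only with a KKT point as solution. *)

theory Defs
  imports "HOL-Probability.Probability"
begin

definition eigenvalues :: "real^'p^'p \<Rightarrow> real set" where
  "eigenvalues Q = {k. \<exists>v. v \<noteq> 0 \<and> Q *v v = k *\<^sub>R v}"

(* Max is meaningful for symmetric Q: the set of real eigenvalues is then finite and nonempty. *)
definition lambda_max :: "real^'p^'p \<Rightarrow> real" where
  "lambda_max Q = Max (eigenvalues Q)"

definition feasible :: "real^'p^'q \<Rightarrow> (real^'p) set" where
  "feasible A = {\<eta>. A *v \<eta> = 0}"

definition objective :: "real^'p^'p \<Rightarrow> real^'p \<Rightarrow> real" where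
  "objective Q \<eta> = 1 / 2 * (\<eta> \<bullet> (Q *v \<eta>))"

definition is_solution :: "real^'p^'p \<Rightarrow> real^'p^'q \<Rightarrow> real^'p \<Rightarrow> bool" where
  "is_solution Q A \<eta> \<longleftrightarrow>
     \<eta> \<in> feasible A \<and> (\<forall>\<xi>\<in>feasible A. objective Q \<eta> \<le> objective Q \<xi>)"

(* First-order (KKT) conditions of the program; nu is the Lagrange multiplier of A eta = 0. *)
definition is_stationary :: "real^'p^'p \<Rightarrow> real^'p^'q \<Rightarrow> real^'p \<Rightarrow> bool" where
  "is_stationary Q A \<eta> \<longleftrightarrow>
     \<eta> \<in> feasible A \<and> (\<exists>\<nu>. Q *v \<eta> + transpose A *v \<nu> = 0)"

definition T1 :: "real^'p^'p \<Rightarrow> real^'p^'q \<Rightarrow> bool" where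
  "T1 Q A \<longleftrightarrow> (\<forall>\<eta>\<in>feasible A. \<eta> \<noteq> 0 \<longrightarrow> \<eta> \<bullet> (Q *v \<eta>) > 0)"

definition T2 :: "real^'p^'p \<Rightarrow> real^'p^'q \<Rightarrow> bool" where
  "T2 Q A \<longleftrightarrow> (\<forall>\<eta>\<in>feasible A. \<eta> \<bullet> (Q *v \<eta>) \<ge> 0) \<and>
     (\<exists>\<eta>\<in>feasible A. \<eta> \<noteq> 0 \<and> \<eta> \<bullet> (Q *v \<eta>) = 0)"

definition T3 :: "real^'p^'p \<Rightarrow> real^'p^'q \<Rightarrow> bool" where
  "T3 Q A \<longleftrightarrow> (\<exists>\<eta>\<in>feasible A. \<eta> \<bullet> (Q *v \<eta>) < 0)"

definition pgd_step :: "real^'p^'p \<Rightarrow> real^'p^'q \<Rightarrow> real \<Rightarrow> real^'p \<Rightarrow> real^'p" where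
  "pgd_step Q A \<alpha> \<eta> =
     (mat 1 - transpose A ** matrix_inv (A ** transpose A) ** A) *v
       ((mat 1 - \<alpha> *\<^sub>R Q) *v \<eta>)"

definition pgd :: "real^'p^'p \<Rightarrow> real^'p^'q \<Rightarrow> real \<Rightarrow> real^'p \<Rightarrow> nat \<Rightarrow> real^'p" where
  "pgd Q A \<alpha> \<eta>0 t = (pgd_step Q A \<alpha> ^^ t) \<eta>0"

definition converges_exp :: "(nat \<Rightarrow> 'a::real_normed_vector) \<Rightarrow> 'a \<Rightarrow> bool" where
  "converges_exp x l \<longleftrightarrow>
     (\<exists>C r. 0 < r \<and> r < 1 \<and> (\<forall>\<^sub>F t in sequentially. norm (x t - l) \<le> C * r ^ t))"

definition diverges_exp :: "(nat \<Rightarrow> 'a::real_normed_vector) \<Rightarrow> bool" where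
  "diverges_exp x \<longleftrightarrow>
     (\<exists>c r. 0 < c \<and> 1 < r \<and> (\<forall>\<^sub>F t in sequentially. c * r ^ t \<le> norm (x t)))"

(* How the termination conditions are read off a run of the iteration: limit zero reports T1,
   a nonzero limit reports T2, and divergence to infinity reports T3. *)
definition reports_T1 :: "(nat \<Rightarrow> 'a::real_normed_vector) \<Rightarrow> bool" where
  "reports_T1 x \<longleftrightarrow> x \<longlonglongrightarrow> 0"

definition reports_T2 :: "(nat \<Rightarrow> 'a::real_normed_vector) \<Rightarrow> bool" where
  "reports_T2 x \<longleftrightarrow> (\<exists>l. l \<noteq> 0 \<and> x \<longlonglongrightarrow> l)"

definition reports_T3 :: "(nat \<Rightarrow> 'a::real_normed_vector) \<Rightarrow> bool" where
  "reports_T3 x \<longleftrightarrow> filterlim x at_infinity sequentially"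

end

theory Submission
  imports Defs "HOL-Real_Asymp.Real_Asymp"
begin

text \<open>
  Let \<open>P\<close> be the orthogonal projection onto \<open>S = feasible A\<close>. The map \<open>x \<mapsto> P (Q x)\<close> is self-adjoint on
  \<open>S\<close>, so \<open>S\<close> has an orthonormal basis of eigenvectors \<open>b\<close>, with eigenvalues \<open>curv b = b \<bullet> Q b\<close>. These are
  at most the largest eigenvalue of \<open>Q\<close>, hence every rate \<open>1 - \<alpha> * curv b\<close> is positive. After the first
  step the iterates lie in \<open>S\<close>, and their \<open>b\<close>-coordinate is multiplied by this rate in every step:
  it decays, stays constant or explodes according to the sign of \<open>curv b\<close>. The initial coordinate
  is \<open>(b - \<alpha> Q b) \<bullet> z\<close>, which vanishes only on a hyperplane, that is with probability zero.
\<close>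

section \<open>Orthonormal eigenbases\<close>

definition orthonormal :: "'a::real_inner set \<Rightarrow> bool" where
  "orthonormal B \<longleftrightarrow> (\<forall>b\<in>B. \<forall>c\<in>B. b \<bullet> c = (if b = c then 1 else 0))"

lemma inner_sum_orthonormal:
  assumes "orthonormal B" "finite B" "b \<in> B"
  shows "b \<bullet> (\<Sum>c\<in>B. h c *\<^sub>R c) = h b"
proof -
  have "b \<bullet> (\<Sum>c\<in>B. h c *\<^sub>R c) = (\<Sum>c\<in>B. if b = c then h c else 0)"
    unfolding inner_sum_right
    by (rule sum.cong) (use assms in \<open>auto simp: orthonormal_def\<close>)
  then show ?thesis using assms by simp
qed

text \<open>The quadratic has value 0 at t = 0, so 0 is a minimum and its derivative p vanishes
  there. This serves as the first-order condition for the Rayleigh maximizer.\<close>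

lemma nonneg_quadratic_linear_coeff_zero:
  fixes p q :: real
  assumes "\<And>t. 0 \<le> t * p + t\<^sup>2 * q"
  shows "p = 0"
proof (rule ccontr)
  assume p: "p \<noteq> 0"
  \<comment> \<open>Any positive k above q makes t = -p/k a point with negative value: the linear
    gain of order 1/k beats the quadratic term.\<close>
  define k where "k = \<bar>q\<bar> + 1"
  have k: "k > 0" "q - k < 0" unfolding k_def by auto
  have "(- p / k) * p + (- p / k)\<^sup>2 * q = p\<^sup>2 / k\<^sup>2 * (q - k)"
    using k(1) by (simp add: field_simps power2_eq_square)
  moreover have "p\<^sup>2 / k\<^sup>2 * (q - k) < 0"
    using p k by (intro mult_pos_neg) auto
  ultimately show False using assms[of "- p / k"] by linarith
qed

text \<open>The form attains its maximum m on the compact unit sphere of \<open>S\<close>;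
  homogeneity extends the bound to all of \<open>S\<close>, and the first-order condition at a
  maximizer is the eigenvector equation.\<close>

lemma Rayleigh_maximizer:
  fixes f :: "'a::euclidean_space \<Rightarrow> 'a"
  assumes "linear f" "subspace S" "\<And>x. x \<in> S \<Longrightarrow> f x \<in> S"
    and sym: "\<And>x y. x \<in> S \<Longrightarrow> y \<in> S \<Longrightarrow> f x \<bullet> y = x \<bullet> f y"
    and "S \<noteq> {0}"
  obtains v m where "v \<in> S" "norm v = 1" "f v = m *\<^sub>R v"
    "\<And>w. w \<in> S \<Longrightarrow> w \<bullet> f w \<le> m * (w \<bullet> w)"
proof -
  interpret f: linear f by fact
  have unit: "w /\<^sub>R norm w \<in> S \<inter> sphere 0 1" if "w \<in> S" "w \<noteq> 0" for w
    using that assms(2) by (simp add: subspace_scale)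
  obtain u where "u \<in> S" "u \<noteq> 0"
    using assms(2,5) subspace_0 by blast
  with unit have "S \<inter> sphere 0 1 \<noteq> {}" by blast
  moreover have "compact (S \<inter> sphere 0 1)"
    using closed_subspace[OF assms(2)] by (intro closed_Int_compact) auto
  moreover have "continuous_on (S \<inter> sphere 0 1) (\<lambda>w. w \<bullet> f w)"
    using assms(1) by (intro continuous_intros linear_continuous_on) (simp add: linear_linear)
  ultimately obtain v where v: "v \<in> S \<inter> sphere 0 1"
    and max: "\<And>w. w \<in> S \<inter> sphere 0 1 \<Longrightarrow> w \<bullet> f w \<le> v \<bullet> f v"
    using continuous_attains_sup[of "S \<inter> sphere 0 1" "\<lambda>w. w \<bullet> f w"] by blast
  define m where "m = v \<bullet> f v"
  have vS: "v \<in> S" "norm v = 1" using v by auto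
  then have vv: "v \<bullet> v = 1" by (simp add: norm_eq_1)
  have bound: "w \<bullet> f w \<le> m * (w \<bullet> w)" if "w \<in> S" for w
  proof (cases "w = 0")
    case False
    have "(w /\<^sub>R norm w) \<bullet> f (w /\<^sub>R norm w) = (w \<bullet> f w) / (w \<bullet> w)"
      by (simp add: f.scale dot_square_norm power2_eq_square field_simps)
    with max[OF unit[OF that False]] have "(w \<bullet> f w) / (w \<bullet> w) \<le> m"
      by (simp add: m_def)
    then show ?thesis using False by (simp add: field_simps)
  qed simp
  \<comment> \<open>The residual of the eigenvector equation serves as its own test direction: the
    derivative of m (w . w) - w . f w at v along d is 2 (d . d), so stationarity gives d =
    0.\<close>
  define d where "d = m *\<^sub>R v - f v"
  have dS: "d \<in> S"
    unfolding d_def using vS assms(2,3) by (intro subspace_diff subspace_scale) auto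
  have "0 \<le> t * (2 * (d \<bullet> d)) + t\<^sup>2 * (m * (d \<bullet> d) - d \<bullet> f d)" for t
  proof -
    have "v + t *\<^sub>R d \<in> S"
      using vS dS assms(2) by (intro subspace_add subspace_scale)
    from bound[OF this]
    have "0 \<le> m * ((v + t *\<^sub>R d) \<bullet> (v + t *\<^sub>R d)) - (v + t *\<^sub>R d) \<bullet> f (v + t *\<^sub>R d)" by simp
    also have "\<dots> = m * (1 + 2 * t * (d \<bullet> v) + t\<^sup>2 * (d \<bullet> d))
        - (m + 2 * t * (d \<bullet> f v) + t\<^sup>2 * (d \<bullet> f d))"
      using sym[OF vS(1) dS] vv
      by (simp add: f.add f.scale inner_add_left inner_add_right power2_eq_square m_def
          inner_commute[of v d] inner_commute[of d "f v"] algebra_simps)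
    also have "\<dots> = t * (2 * (d \<bullet> (m *\<^sub>R v - f v))) + t\<^sup>2 * (m * (d \<bullet> d) - d \<bullet> f d)"
      by (simp add: inner_diff_right algebra_simps)
    finally show ?thesis unfolding d_def .
  qed
  then have "2 * (d \<bullet> d) = 0" by (rule nonneg_quadratic_linear_coeff_zero)
  then have "f v = m *\<^sub>R v" by (simp add: d_def)
  then show thesis using that vS bound by blast
qed

text \<open>Split off a unit eigenvector v and continue in its orthogonal complement within
  \<open>S\<close>, which f preserves by self-adjointness. Symmetry is demanded only on
  \<open>S\<close>, because the projected matrix need not be symmetric on the whole space.\<close>

lemma ex_orthonormal_eigenbasis:
  fixes f :: "'a::euclidean_space \<Rightarrow> 'a"
  assumes "linear f" "subspace S" "\<And>x. x \<in> S \<Longrightarrow> f x \<in> S"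
    and "\<And>x y. x \<in> S \<Longrightarrow> y \<in> S \<Longrightarrow> f x \<bullet> y = x \<bullet> f y"
  shows "\<exists>B. finite B \<and> B \<subseteq> S \<and> orthonormal B \<and> (\<forall>b\<in>B. \<exists>m. f b = m *\<^sub>R b) \<and>
    (\<forall>x\<in>S. x = (\<Sum>b\<in>B. (b \<bullet> x) *\<^sub>R b))"
  using assms(2-4)
proof (induction "dim S" arbitrary: S rule: less_induct)
  case less
  show ?case
  proof (cases "S = {0}")
    case True
    then show ?thesis by (intro exI[of _ "{}"]) (simp add: orthonormal_def)
  next
    case False
    obtain v m where v: "v \<in> S" "norm v = 1" "f v = m *\<^sub>R v"
      using Rayleigh_maximizer[OF assms(1) less.prems False] by metis
    have vv: "v \<bullet> v = 1" using v(2) by (simp add: norm_eq_1)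
    define S' where "S' = {x\<in>S. v \<bullet> x = 0}"
    have sub: "subspace S'"
      using less.prems(1) by (auto simp: S'_def subspace_def inner_add_right)
    have inv: "f x \<in> S'" if "x \<in> S'" for x
    proof -
      have "v \<bullet> f x = f v \<bullet> x"
        using that v(1) less.prems(3)[of v x] by (auto simp: S'_def)
      with that show ?thesis using less.prems(2) v(3) by (auto simp: S'_def)
    qed
    have "v \<notin> S'" using vv by (simp add: S'_def)
    moreover have "S' \<subseteq> S" by (auto simp: S'_def)
    ultimately have "S' \<subset> S" using v(1) by blast
    then have "dim S' < dim S"
      using less.prems(1) sub by (metis dim_psubset span_eq_iff)
    from less.hyps[OF this sub inv] obtain B where B: "finite B" "B \<subseteq> S'" "orthonormal B"
      "\<forall>b\<in>B. \<exists>m. f b = m *\<^sub>R b" "\<forall>x\<in>S'. x = (\<Sum>b\<in>B. (b \<bullet> x) *\<^sub>R b)"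
      using less.prems(3) S'_def by auto
    have vB: "v \<notin> B" and perp: "\<And>b. b \<in> B \<Longrightarrow> v \<bullet> b = 0"
      using B(2) \<open>v \<notin> S'\<close> by (auto simp: S'_def)
    have "x = (\<Sum>b\<in>insert v B. (b \<bullet> x) *\<^sub>R b)" if x: "x \<in> S" for x
    proof -
      \<comment> \<open>Removing the v-component lands in \<open>S'\<close> and leaves the other
        coefficients unchanged, since v is orthogonal to \<open>B\<close>.\<close>
      let ?y = "x - (v \<bullet> x) *\<^sub>R v"
      have "?y \<in> S'"
        using x v(1) vv less.prems(1)
        by (auto simp: S'_def inner_diff_right intro: subspace_diff subspace_scale)
      then have "?y = (\<Sum>b\<in>B. (b \<bullet> ?y) *\<^sub>R b)" using B(5) by blast
      also have "\<dots> = (\<Sum>b\<in>B. (b \<bullet> x) *\<^sub>R b)"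
        by (rule sum.cong) (use perp in \<open>auto simp: inner_diff_right inner_commute\<close>)
      finally show ?thesis using B(1) vB by (simp add: algebra_simps)
    qed
    moreover have "orthonormal (insert v B)"
      using B(3) perp vv vB by (auto simp: orthonormal_def inner_commute)
    ultimately show ?thesis
      using B v \<open>S' \<subset> S\<close> by (intro exI[of _ "insert v B"]) auto
  qed
qed

text \<open>The Rayleigh maximum bounds the form and is itself an eigenvalue. To compare it with
  \<open>Max\<close>, the spectrum must be finite: every eigenvalue is the value of the form at some
  member of a finite eigenbasis.\<close>

lemma quadratic_form_le_lambda_max:
  fixes Q :: "real^'p^'p"
  assumes "transpose Q = Q"
  shows "w \<bullet> (Q *v w) \<le> lambda_max Q * (w \<bullet> w)"
proof -
  have sym: "(Q *v x) \<bullet> y = x \<bullet> (Q *v y)" for x y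
    using dot_lmul_matrix[of x Q y] assms
    by (metis transpose_matrix_vector)
  have "\<exists>B. finite B \<and> B \<subseteq> UNIV \<and> orthonormal B \<and> (\<forall>b\<in>B. \<exists>m. Q *v b = m *\<^sub>R b) \<and>
    (\<forall>x\<in>UNIV. x = (\<Sum>b\<in>B. (b \<bullet> x) *\<^sub>R b))"
    by (rule ex_orthonormal_eigenbasis) (auto simp: sym)
  then obtain B where B: "finite B" "\<forall>b\<in>B. \<exists>m. Q *v b = m *\<^sub>R b"
    "\<And>x. x = (\<Sum>b\<in>B. (b \<bullet> x) *\<^sub>R b)" "orthonormal B" by auto
  have "eigenvalues Q \<subseteq> (\<lambda>b. b \<bullet> (Q *v b)) ` B"
  proof
    fix k assume "k \<in> eigenvalues Q"
    then obtain v where v: "v \<noteq> 0" "Q *v v = k *\<^sub>R v" by (auto simp: eigenvalues_def)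
    \<comment> \<open>An eigenvector cannot be orthogonal to the whole basis; pairing its equation
      with a b that it meets identifies its eigenvalue with that of b.\<close>
    have "\<exists>b\<in>B. b \<bullet> v \<noteq> 0"
    proof (rule ccontr)
      assume "\<not> ?thesis"
      then have "(\<Sum>b\<in>B. (b \<bullet> v) *\<^sub>R b) = 0" by (intro sum.neutral) auto
      with B(3)[of v] v(1) show False by simp
    qed
    then obtain b where b: "b \<in> B" "b \<bullet> v \<noteq> 0" by blast
    then obtain m where m: "Q *v b = m *\<^sub>R b" using B by blast
    have "k * (b \<bullet> v) = m * (b \<bullet> v)"
      using sym[of b v] m v(2) by (metis inner_scaleR_left inner_scaleR_right)
    moreover have "b \<bullet> (Q *v b) = m"
      using m b(1) B(4) by (simp add: orthonormal_def)
    ultimately have "k = b \<bullet> (Q *v b)" using b(2) by simp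
    then show "k \<in> (\<lambda>b. b \<bullet> (Q *v b)) ` B" using b(1) by blast
  qed
  then have fin: "finite (eigenvalues Q)" using B(1) finite_surj by blast
  have "(UNIV :: (real^'p) set) \<noteq> {0}"
    by (metis UNIV_I singletonD zero_neq_one)
  then obtain v m where v: "norm v = 1" "Q *v v = m *\<^sub>R v"
    "\<And>w. w \<bullet> (Q *v w) \<le> m * (w \<bullet> w)"
    using Rayleigh_maximizer[of "(*v) Q" UNIV] sym by auto
  have "m \<in> eigenvalues Q"
    using v by (auto simp: eigenvalues_def intro!: exI[of _ v])
  then have "m \<le> lambda_max Q" unfolding lambda_max_def using fin by simp
  then have "m * (w \<bullet> w) \<le> lambda_max Q * (w \<bullet> w)" by (simp add: mult_right_mono)
  with v(3)[of w] show ?thesis by linarith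
qed

section \<open>Exponential convergence and divergence of diagonal iterations\<close>

lemma diverges_exp_imp_at_infinity:
  assumes "diverges_exp x"
  shows "filterlim x at_infinity sequentially"
proof -
  obtain c r where cr: "0 < c" "1 < r" "\<forall>\<^sub>F t in sequentially. c * r ^ t \<le> norm (x t)"
    using assms by (auto simp: diverges_exp_def)
  have "filterlim (\<lambda>t. c * r ^ t) at_top sequentially"
    using cr(1,2) by real_asymp
  then have "filterlim (\<lambda>t. norm (x t)) at_top sequentially"
    using cr(3) by (rule filterlim_at_top_mono)
  then show ?thesis by (rule filterlim_norm_at_top_imp_at_infinity)
qed

lemma converges_exp_imp_tendsto:
  assumes "converges_exp x l"
  shows "x \<longlonglongrightarrow> l"
proof -
  obtain C r where r: "0 < r" "r < 1" "\<forall>\<^sub>F t in sequentially. norm (x t - l) \<le> C * r ^ t"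
    using assms by (auto simp: converges_exp_def)
  have "(\<lambda>t. C * r ^ t) \<longlonglongrightarrow> 0"
    using r by (intro tendsto_mult_right_zero LIMSEQ_realpow_zero) auto
  then have "(\<lambda>t. x t - l) \<longlonglongrightarrow> 0"
    using r(3) by (rule Lim_null_comparison[rotated])
  then show ?thesis by (simp add: LIM_zero_iff)
qed

text \<open>By Cauchy-Schwarz the norm dominates the single coordinate along b, which already grows
  geometrically.\<close>

lemma diagonal_diverges_exp:
  assumes B: "orthonormal B" "finite B"
    and x: "\<And>t. x (Suc t) = (\<Sum>b\<in>B. (r b ^ t * c b) *\<^sub>R b)"
    and b: "b \<in> B" "r b > 1" "c b \<noteq> 0"
  shows "diverges_exp x"
proof -
  \<comment> \<open>The division by \<open>r b\<close> compensates for the exponent t at index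
    \<open>Suc t\<close>.\<close>
  have bnd: "\<bar>c b\<bar> / r b * r b ^ Suc t \<le> norm (x (Suc t))" for t
  proof -
    have nb: "norm b = 1" using B(1) b(1) by (simp add: orthonormal_def norm_eq_1)
    have "\<bar>c b\<bar> / r b * r b ^ Suc t = \<bar>r b ^ t * c b\<bar>"
      using b(2) by (simp add: abs_mult)
    also have "\<dots> = \<bar>b \<bullet> x (Suc t)\<bar>"
      unfolding x using inner_sum_orthonormal[OF B b(1), of "\<lambda>b. r b ^ t * c b"] by simp
    also have "\<dots> \<le> norm (x (Suc t))"
      using Cauchy_Schwarz_ineq2[of b "x (Suc t)"] nb by simp
    finally show ?thesis .
  qed
  have "\<forall>\<^sub>F t in sequentially. \<bar>c b\<bar> / r b * r b ^ t \<le> norm (x t)"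
    using bnd by (subst eventually_sequentially_Suc[symmetric]) (rule always_eventually, blast)
  moreover have "0 < \<bar>c b\<bar> / r b" using b by simp
  ultimately show ?thesis
    unfolding diverges_exp_def using b(2) by blast
qed

text \<open>Coordinates of rate 1 are constant and form the limit, those of larger rate are absent,
  and the finitely many others decay at least as fast as the slowest of them.\<close>

lemma diagonal_converges_exp:
  assumes B: "orthonormal B" "finite B"
    and x: "\<And>t. x (Suc t) = (\<Sum>b\<in>B. (r b ^ t * c b) *\<^sub>R b)"
    and pos: "\<And>b. b \<in> B \<Longrightarrow> 0 < r b"
    and stable: "\<And>b. b \<in> B \<Longrightarrow> r b > 1 \<Longrightarrow> c b = 0"
  shows "converges_exp x (\<Sum>b\<in>B. (if r b = 1 then c b else 0) *\<^sub>R b)"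
proof -
  \<comment> \<open>Inserting 1/2 keeps the set nonempty and q strictly between 0 and 1 even if no
    rate lies below 1.\<close>
  define q where "q = Max (insert (1/2) (r ` {b\<in>B. r b < 1}))"
  define l where "l = (\<Sum>b\<in>B. (if r b = 1 then c b else 0) *\<^sub>R b)"
  have fin: "finite (insert (1/2) (r ` {b\<in>B. r b < 1}))" using B(2) by simp
  have "1/2 \<le> q" unfolding q_def using fin by (intro Max_ge) auto
  then have q0: "0 < q" by simp
  have q1: "q < 1" unfolding q_def using fin by (subst Max_less_iff) auto
  have qr: "r b \<le> q" if "b \<in> B" "r b < 1" for b
    unfolding q_def using fin that by (intro Max_ge) auto
  have bnd: "norm (x (Suc t) - l) \<le> (\<Sum>b\<in>B. \<bar>c b\<bar>) / q * q ^ Suc t" for t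
  proof -
    have "x (Suc t) - l = (\<Sum>b\<in>B. (r b ^ t * c b - (if r b = 1 then c b else 0)) *\<^sub>R b)"
      by (simp add: x l_def sum_subtractf scaleR_diff_left)
    also have "norm \<dots> \<le> (\<Sum>b\<in>B. q ^ t * \<bar>c b\<bar>)"
    proof (rule sum_norm_le)
      fix b assume b: "b \<in> B"
      then have nb: "norm b = 1" using B(1) by (simp add: orthonormal_def norm_eq_1)
      consider "r b < 1" | "r b = 1" | "r b > 1" by linarith
      then show "norm ((r b ^ t * c b - (if r b = 1 then c b else 0)) *\<^sub>R b) \<le> q ^ t * \<bar>c b\<bar>"
      proof cases
        case 1
        then have "r b ^ t \<le> q ^ t"
          using b pos[OF b] qr by (intro power_mono) auto
        then have "r b ^ t * \<bar>c b\<bar> \<le> q ^ t * \<bar>c b\<bar>" by (intro mult_right_mono) auto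
        then show ?thesis using 1 nb pos[OF b] by (simp add: abs_mult)
      qed (use stable b q0 in auto)
    qed
    also have "\<dots> = (\<Sum>b\<in>B. \<bar>c b\<bar>) / q * q ^ Suc t"
      using q0 by (simp add: mult.commute flip: sum_distrib_right)
    finally show ?thesis .
  qed
  have "\<forall>\<^sub>F t in sequentially. norm (x t - l) \<le> (\<Sum>b\<in>B. \<bar>c b\<bar>) / q * q ^ t"
    using bnd by (subst eventually_sequentially_Suc[symmetric]) (rule always_eventually, blast)
  then show ?thesis
    unfolding converges_exp_def l_def[symmetric] using q0 q1 by blast
qed

section \<open>The projection and the spectral form of the iteration\<close>

text \<open>For \<open>A\<close> of full row rank this is the orthogonal projector onto the kernel
  of \<open>A\<close>.\<close>

definition feasible_proj :: "real^'p^'q \<Rightarrow> real^'p^'p" where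
  "feasible_proj A = mat 1 - transpose A ** matrix_inv (A ** transpose A) ** A"

lemma subspace_feasible: "subspace (feasible A)"
  by (auto simp: subspace_def feasible_def matrix_vector_right_distrib matrix_vector_mult_scaleR)

text \<open>If the Gram matrix kills y, then the squared norm of \<open>transpose A *v y\<close> is
  0, and full row rank makes the transpose injective.\<close>

lemma Gram_matrix_inv:
  fixes A :: "real^'p^'q"
  assumes "rank A = CARD('q)"
  shows "(A ** transpose A) ** matrix_inv (A ** transpose A) = mat 1"
proof -
  have inj: "inj ((*v) (transpose A))"
    using assms by (simp add: full_rank_injective[symmetric] rank_transpose)
  have "inj ((*v) (A ** transpose A))"
  proof (subst linear_injective_0)
    show "linear ((*v) (A ** transpose A))" by simp
    show "\<forall>y. (A ** transpose A) *v y = 0 \<longrightarrow> y = 0"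
    proof (intro allI impI)
      fix y assume "(A ** transpose A) *v y = 0"
      then have "y \<bullet> (A *v (transpose A *v y)) = 0"
        by (metis inner_zero_right matrix_vector_mul_assoc)
      then have "(transpose A *v y) \<bullet> (transpose A *v y) = 0"
        by (metis dot_lmul_matrix transpose_matrix_vector)
      then have "transpose A *v y = transpose A *v 0" by simp
      then show "y = 0" using inj by (metis injD)
    qed
  qed
  then have "invertible (A ** transpose A)"
    using invertible_left_inverse matrix_left_invertible_injective by blast
  then show ?thesis
    unfolding invertible_def matrix_inv_def by (rule someI_ex[THEN conjunct1])
qed

lemma feasible_proj_vec:
  "feasible_proj A *v x =
     x - transpose A *v (matrix_inv (A ** transpose A) *v (A *v x))"
  by (simp add: feasible_proj_def matrix_vector_mult_diff_rdistrib matrix_vector_mul_assoc matrix_mul_assoc)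

lemma feasible_proj_in:
  fixes A :: "real^'p^'q"
  assumes "rank A = CARD('q)"
  shows "feasible_proj A *v x \<in> feasible A"
proof -
  have "A *v (transpose A *v (matrix_inv (A ** transpose A) *v (A *v x))) = A *v x"
    by (metis Gram_matrix_inv[OF assms] matrix_vector_mul_assoc matrix_vector_mul_lid)
  then show ?thesis
    by (simp add: feasible_proj_vec feasible_def matrix_vector_mult_diff_distrib)
qed

lemma feasible_proj_inner:
  assumes "y \<in> feasible A"
  shows "y \<bullet> (feasible_proj A *v x) = y \<bullet> x"
proof -
  have "y \<bullet> (transpose A *v u) = 0" for u
    using dot_lmul_matrix[of u A y] assms by (simp add: feasible_def inner_commute)
  then show ?thesis by (simp add: feasible_proj_vec inner_diff_right)
qed

lemma pgd_step_eq: "pgd_step Q A \<alpha> z = feasible_proj A *v (z - \<alpha> *\<^sub>R (Q *v z))"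
  by (simp add: pgd_step_def feasible_proj_def matrix_vector_mult_diff_rdistrib
      scaleR_matrix_vector_assoc)

text \<open>The upper bound on the step size is conditional: when the largest eigenvalue is not
  positive, its reciprocal is no meaningful bound and every positive step size is
  admissible.\<close>

locale pgd_problem =
  fixes Q :: "real^'p^'p" and A :: "real^'p^'q" and \<alpha> :: real
  assumes symQ: "transpose Q = Q"
    and full_rank: "rank A = CARD('q)"
    and \<alpha>_pos: "0 < \<alpha>"
    and \<alpha>_less: "lambda_max Q > 0 \<longrightarrow> \<alpha> < 1 / lambda_max Q"
begin

lemma Q_inner: "(Q *v x) \<bullet> y = x \<bullet> (Q *v y)"
  using dot_lmul_matrix[of x Q y] symQ by (metis transpose_matrix_vector)

text \<open>Positivity excludes oscillation and factors of modulus at least 1 with negative sign, so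
  the sign of the curvature alone decides the behaviour of a coordinate.\<close>

lemma contraction_factor_pos:
  assumes "norm b = 1"
  shows "0 < 1 - \<alpha> * (b \<bullet> (Q *v b))"
proof -
  have "b \<bullet> (Q *v b) \<le> lambda_max Q"
    using quadratic_form_le_lambda_max[OF symQ, of b] assms by (simp add: norm_eq_1)
  then have "\<alpha> * (b \<bullet> (Q *v b)) \<le> \<alpha> * lambda_max Q"
    using \<alpha>_pos by simp
  also have "\<alpha> * lambda_max Q < 1"
  proof (cases "lambda_max Q > 0")
    case True
    then show ?thesis using \<alpha>_less by (simp add: field_simps)
  next
    case False
    then have "\<alpha> * lambda_max Q \<le> 0" using \<alpha>_pos by (simp add: mult_nonneg_nonpos)
    then show ?thesis by linarith
  qed
  finally show ?thesis by simp
qed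

section \<open>Eigenbasis of the projected matrix on the feasible space\<close>

definition curv :: "real^'p \<Rightarrow> real" where "curv b = b \<bullet> (Q *v b)"

text \<open>Chosen once from \<open>Q\<close> and \<open>A\<close>, independently of the starting
  point, so that the exceptional hyperplanes are fixed before the initialization is drawn.\<close>

definition eigenbasis :: "(real^'p) set" where
  "eigenbasis = (SOME B. finite B \<and> B \<subseteq> feasible A \<and> orthonormal B \<and>
     (\<forall>b\<in>B. \<exists>m. feasible_proj A *v (Q *v b) = m *\<^sub>R b) \<and>
     (\<forall>x\<in>feasible A. x = (\<Sum>b\<in>B. (b \<bullet> x) *\<^sub>R b)))"

lemma eigenbasis:
  shows finite_eigenbasis: "finite eigenbasis"
    and eigenbasis_feasible: "b \<in> eigenbasis \<Longrightarrow> b \<in> feasible A"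
    and orthonormal_eigenbasis: "orthonormal eigenbasis"
    and eigenbasis_eigen: "b \<in> eigenbasis \<Longrightarrow> feasible_proj A *v (Q *v b) = curv b *\<^sub>R b"
    and eigenbasis_expand: "x \<in> feasible A \<Longrightarrow> x = (\<Sum>b\<in>eigenbasis. (b \<bullet> x) *\<^sub>R b)"
    and norm_eigenbasis: "b \<in> eigenbasis \<Longrightarrow> norm b = 1"
proof -
  have "\<exists>B. finite B \<and> B \<subseteq> feasible A \<and> orthonormal B \<and>
     (\<forall>b\<in>B. \<exists>m. feasible_proj A *v (Q *v b) = m *\<^sub>R b) \<and>
     (\<forall>x\<in>feasible A. x = (\<Sum>b\<in>B. (b \<bullet> x) *\<^sub>R b))"
  proof (rule ex_orthonormal_eigenbasis)
    show "linear (\<lambda>x. feasible_proj A *v (Q *v x))"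
      by (simp add: matrix_vector_mul_assoc)
    fix x y assume "x \<in> feasible A" "y \<in> feasible A"
    then show "(feasible_proj A *v (Q *v x)) \<bullet> y = x \<bullet> (feasible_proj A *v (Q *v y))"
      by (metis Q_inner feasible_proj_inner inner_commute)
  qed (use subspace_feasible feasible_proj_in[OF full_rank] in auto)
  from someI_ex[OF this, folded eigenbasis_def]
  have *: "finite eigenbasis" "eigenbasis \<subseteq> feasible A" "orthonormal eigenbasis"
    "\<forall>b\<in>eigenbasis. \<exists>m. feasible_proj A *v (Q *v b) = m *\<^sub>R b"
    "\<forall>x\<in>feasible A. x = (\<Sum>b\<in>eigenbasis. (b \<bullet> x) *\<^sub>R b)"
    by auto
  show "finite eigenbasis" "orthonormal eigenbasis" using * by auto
  show "x \<in> feasible A \<Longrightarrow> x = (\<Sum>b\<in>eigenbasis. (b \<bullet> x) *\<^sub>R b)" using * by blast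
  assume b: "b \<in> eigenbasis"
  then show bA: "b \<in> feasible A" using * by auto
  show nb: "norm b = 1" using * b by (simp add: orthonormal_def norm_eq_1)
  obtain m where m: "feasible_proj A *v (Q *v b) = m *\<^sub>R b" using * b by blast
  \<comment> \<open>Pairing with the unit vector b isolates m; the projection then drops out because
    b is feasible.\<close>
  then have "m = b \<bullet> (feasible_proj A *v (Q *v b))" using nb by (simp add: norm_eq_1)
  then have "m = curv b" using feasible_proj_inner[OF bA] by (simp add: curv_def)
  with m show "feasible_proj A *v (Q *v b) = curv b *\<^sub>R b" by simp
qed

lemma eigenbasis_inner_Q:
  assumes "b \<in> eigenbasis" "x \<in> feasible A"
  shows "b \<bullet> (Q *v x) = curv b * (b \<bullet> x)"
proof -
  have "b \<bullet> (Q *v x) = x \<bullet> (Q *v b)" by (metis Q_inner inner_commute)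
  also have "\<dots> = x \<bullet> (feasible_proj A *v (Q *v b))"
    using assms(2) by (simp add: feasible_proj_inner)
  finally show ?thesis using assms(1) by (simp add: eigenbasis_eigen inner_commute)
qed

lemma quadratic_form_expand:
  assumes "x \<in> feasible A"
  shows "x \<bullet> (Q *v x) = (\<Sum>b\<in>eigenbasis. curv b * (b \<bullet> x)\<^sup>2)"
proof -
  have "x \<bullet> (Q *v x) = (\<Sum>b\<in>eigenbasis. (b \<bullet> x) *\<^sub>R b) \<bullet> (Q *v x)"
    using eigenbasis_expand[OF assms] by simp
  also have "\<dots> = (\<Sum>b\<in>eigenbasis. curv b * (b \<bullet> x)\<^sup>2)"
    unfolding inner_sum_left
    by (rule sum.cong) (simp_all add: eigenbasis_inner_Q assms power2_eq_square)
  finally show ?thesis .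
qed

section \<open>Iterates in eigenbasis coordinates and their limit\<close>

definition rate :: "real^'p \<Rightarrow> real" where "rate b = 1 - \<alpha> * curv b"

text \<open>Pairing a start z with this vector gives the b-coordinate after one step. It is not a
  multiple of b in general, since z may be infeasible.\<close>

definition dual :: "real^'p \<Rightarrow> real^'p" where "dual b = b - \<alpha> *\<^sub>R (Q *v b)"

lemma rate_pos: "b \<in> eigenbasis \<Longrightarrow> 0 < rate b"
  unfolding rate_def curv_def by (intro contraction_factor_pos norm_eigenbasis)

lemma rate_gt_1: "rate b > 1 \<longleftrightarrow> curv b < 0"
  using \<alpha>_pos by (simp add: rate_def mult_less_0_iff)

lemma rate_eq_1: "rate b = 1 \<longleftrightarrow> curv b = 0"
  using \<alpha>_pos by (simp add: rate_def)

text \<open>The inner product of b with \<open>dual b\<close> is \<open>rate b\<close>, which is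
  positive. Thus the starts with vanishing coordinate form a genuine hyperplane.\<close>

lemma dual_nonzero:
  assumes "b \<in> eigenbasis"
  shows "dual b \<noteq> 0"
proof
  assume "dual b = 0"
  then have "b \<bullet> dual b = 0" by simp
  then have "rate b = 0"
    using norm_eigenbasis[OF assms]
    by (simp add: dual_def rate_def curv_def inner_diff_right norm_eq_1)
  then show False using rate_pos[OF assms] by simp
qed

text \<open>The formula begins at index 1, the first iterate sure to be feasible; from there each
  step multiplies the b-coordinate by its rate.\<close>

lemma pgd_expand: "pgd Q A \<alpha> z (Suc t) = (\<Sum>b\<in>eigenbasis. (rate b ^ t * (dual b \<bullet> z)) *\<^sub>R b)"
proof -
  have step: "pgd Q A \<alpha> z (Suc t) = pgd_step Q A \<alpha> (pgd Q A \<alpha> z t)" for t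
    by (simp add: pgd_def)
  have feas: "pgd Q A \<alpha> z (Suc t) \<in> feasible A" for t
    unfolding step pgd_step_eq by (rule feasible_proj_in[OF full_rank])
  have "b \<bullet> pgd Q A \<alpha> z (Suc t) = rate b ^ t * (dual b \<bullet> z)" if b: "b \<in> eigenbasis" for b t
  proof (induction t)
    case 0
    \<comment> \<open>The projection drops out against b, and symmetry of \<open>Q\<close> moves the
      gradient step from z onto b.\<close>
    have "b \<bullet> pgd Q A \<alpha> z (Suc 0) = b \<bullet> (z - \<alpha> *\<^sub>R (Q *v z))"
      unfolding step pgd_step_eq using eigenbasis_feasible[OF b]
      by (simp add: feasible_proj_inner pgd_def)
    then show ?case by (simp add: dual_def inner_diff_left inner_diff_right Q_inner)
  next
    case (Suc t)
    let ?x = "pgd Q A \<alpha> z (Suc t)"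
    have "b \<bullet> pgd Q A \<alpha> z (Suc (Suc t)) = b \<bullet> (?x - \<alpha> *\<^sub>R (Q *v ?x))"
      unfolding step[of "Suc t"] pgd_step_eq
      using eigenbasis_feasible[OF b] by (simp add: feasible_proj_inner)
    also have "\<dots> = rate b * (b \<bullet> ?x)"
      using eigenbasis_inner_Q[OF b feas[of t]] by (simp add: inner_diff_right rate_def algebra_simps)
    finally show ?case using Suc.IH by simp
  qed
  then show ?thesis using eigenbasis_expand[OF feas[of t]] by simp
qed

text \<open>Only the flat directions, those of rate 1, survive. The iterates tend to this vector
  provided that the coordinates of negative curvature vanish.\<close>

definition pgd_limit :: "real^'p \<Rightarrow> real^'p" where
  "pgd_limit z = (\<Sum>b\<in>eigenbasis. (if curv b = 0 then dual b \<bullet> z else 0) *\<^sub>R b)"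

lemma inner_pgd_limit:
  "b \<in> eigenbasis \<Longrightarrow> b \<bullet> pgd_limit z = (if curv b = 0 then dual b \<bullet> z else 0)"
  unfolding pgd_limit_def
  by (rule inner_sum_orthonormal[OF orthonormal_eigenbasis finite_eigenbasis])

lemma pgd_limit_feasible: "pgd_limit z \<in> feasible A"
  unfolding pgd_limit_def
  by (intro subspace_sum subspace_scale subspace_feasible eigenbasis_feasible)

lemma pgd_limit_quadratic_form: "pgd_limit z \<bullet> (Q *v pgd_limit z) = 0"
  unfolding quadratic_form_expand[OF pgd_limit_feasible]
  by (rule sum.neutral) (simp add: inner_pgd_limit)

lemma is_stationary_pgd_limit: "is_stationary Q A (pgd_limit z)"
proof -
  let ?l = "pgd_limit z" and ?P = "feasible_proj A"
  have "?P *v (Q *v ?l) = 0"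
  proof -
    have "b \<bullet> (?P *v (Q *v ?l)) = 0" if "b \<in> eigenbasis" for b
      using that by (simp add: feasible_proj_inner eigenbasis_feasible eigenbasis_inner_Q
          pgd_limit_feasible inner_pgd_limit)
    then show ?thesis
      using eigenbasis_expand[OF feasible_proj_in[OF full_rank, of "Q *v ?l"]] by simp
  qed
  \<comment> \<open>A vector killed by the projection equals its own row-space part, whose
    coefficient vector, negated, is the Lagrange multiplier.\<close>
  then have "Q *v ?l + transpose A *v (- (matrix_inv (A ** transpose A) *v (A *v (Q *v ?l)))) = 0"
    by (metis feasible_proj_vec diff_conv_add_uminus linear_neg matrix_vector_mul_linear)
  then show ?thesis unfolding is_stationary_def using pgd_limit_feasible by blast
qed

lemma pgd_diverges:
  assumes "b \<in> eigenbasis" "curv b < 0" "dual b \<bullet> z \<noteq> 0"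
  shows "diverges_exp (pgd Q A \<alpha> z)"
  using diagonal_diverges_exp[OF orthonormal_eigenbasis finite_eigenbasis pgd_expand] assms rate_gt_1
  by blast

lemma pgd_converges:
  assumes "\<And>b. b \<in> eigenbasis \<Longrightarrow> curv b < 0 \<Longrightarrow> dual b \<bullet> z = 0"
  shows "converges_exp (pgd Q A \<alpha> z) (pgd_limit z)"
  using diagonal_converges_exp[OF orthonormal_eigenbasis finite_eigenbasis pgd_expand rate_pos]
    assms
  by (simp add: pgd_limit_def rate_gt_1 rate_eq_1)

section \<open>Spectral reading of the termination conditions\<close>

lemma T3_iff: "T3 Q A \<longleftrightarrow> (\<exists>b\<in>eigenbasis. curv b < 0)"
proof
  assume "T3 Q A"
  then obtain x where x: "x \<in> feasible A" "x \<bullet> (Q *v x) < 0" by (auto simp: T3_def)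
  show "\<exists>b\<in>eigenbasis. curv b < 0"
  proof (rule ccontr)
    assume "\<not> ?thesis"
    then have "0 \<le> (\<Sum>b\<in>eigenbasis. curv b * (b \<bullet> x)\<^sup>2)"
      by (intro sum_nonneg) (auto simp: not_less)
    with x show False by (simp add: quadratic_form_expand)
  qed
qed (auto simp: T3_def curv_def dest: eigenbasis_feasible)

text \<open>All curvatures are nonnegative here. If none were zero, a vanishing sum of positively
  weighted squares would force every coordinate of x, hence x, to be 0.\<close>

lemma T2_eigenvector:
  assumes "T2 Q A"
  shows "\<exists>b\<in>eigenbasis. curv b = 0"
proof (rule ccontr)
  assume neq: "\<not> ?thesis"
  obtain x where x: "x \<in> feasible A" "x \<noteq> 0" "x \<bullet> (Q *v x) = 0"
    using assms by (auto simp: T2_def)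
  have pos: "curv b > 0" if "b \<in> eigenbasis" for b
  proof -
    have "curv b \<ge> 0"
      using assms eigenbasis_feasible[OF that] by (auto simp: T2_def curv_def)
    with neq that show ?thesis by force
  qed
  have "(\<Sum>b\<in>eigenbasis. curv b * (b \<bullet> x)\<^sup>2) = 0"
    using x by (simp add: quadratic_form_expand)
  then have "\<forall>b\<in>eigenbasis. curv b * (b \<bullet> x)\<^sup>2 = 0"
    by (subst (asm) sum_nonneg_eq_0_iff) (auto simp: finite_eigenbasis dest: pos)
  then have "b \<bullet> x = 0" if "b \<in> eigenbasis" for b
    using pos[OF that] that by auto
  then show False using eigenbasis_expand[OF x(1)] x(2) by simp
qed

lemma T1_pgd_limit:
  assumes "T1 Q A"
  shows "pgd_limit z = 0"
  using assms pgd_limit_feasible pgd_limit_quadratic_form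
  by (force simp: T1_def)

lemma T_cases: "T1 Q A \<or> T2 Q A \<or> T3 Q A"
  unfolding T1_def T2_def T3_def by (meson leI order_antisym_conv)

lemma T_disjoint: "\<not> (T1 Q A \<and> T2 Q A)" "\<not> (T1 Q A \<and> T3 Q A)" "\<not> (T2 Q A \<and> T3 Q A)"
  by (force simp: T1_def T2_def T3_def not_less[symmetric])+

text \<open>The form is nonnegative on the feasible space and vanishes at the limit, which is
  therefore a minimizer; no direction of negative curvature is present.\<close>

lemma not_T3_pgd_converges:
  assumes "\<not> T3 Q A"
  shows "is_solution Q A (pgd_limit z)" "converges_exp (pgd Q A \<alpha> z) (pgd_limit z)"
proof -
  show "is_solution Q A (pgd_limit z)"
    using assms pgd_limit_feasible pgd_limit_quadratic_form
    by (auto simp: is_solution_def objective_def T3_def not_less)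
  show "converges_exp (pgd Q A \<alpha> z) (pgd_limit z)"
    using assms by (intro pgd_converges) (auto simp: T3_iff)
qed

text \<open>Scaling a feasible direction of negative curvature makes the objective unbounded
  below.\<close>

lemma is_solution_imp_not_T3:
  assumes "is_solution Q A s"
  shows "\<not> T3 Q A"
proof
  assume "T3 Q A"
  then obtain x where x: "x \<in> feasible A" "x \<bullet> (Q *v x) < 0" by (auto simp: T3_def)
  \<comment> \<open>Scaling x by the square root of k multiplies the form by k, bringing it strictly
    below its value at s.\<close>
  define k where "k = (\<bar>s \<bullet> (Q *v s)\<bar> + 1) / - (x \<bullet> (Q *v x))"
  have k: "k \<ge> 0" "k * (x \<bullet> (Q *v x)) = - (\<bar>s \<bullet> (Q *v s)\<bar> + 1)"
    using x by (auto simp: k_def field_simps)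
  have "sqrt k *\<^sub>R x \<in> feasible A" using x subspace_feasible subspace_scale by blast
  then have "s \<bullet> (Q *v s) \<le> (sqrt k *\<^sub>R x) \<bullet> (Q *v (sqrt k *\<^sub>R x))"
    using assms unfolding is_solution_def objective_def by fastforce
  also have "\<dots> = k * (x \<bullet> (Q *v x))"
    using k(1) by (simp add: matrix_vector_mult_scaleR flip: mult.assoc)
  finally show False using k(2) by linarith
qed

text \<open>Only the three forward implications need dynamics. Their converses follow because the
  conditions are exhaustive and the reports mutually exclusive.\<close>

lemma pgd_reports:
  assumes generic: "\<And>b. b \<in> eigenbasis \<Longrightarrow> dual b \<bullet> z \<noteq> 0"
  shows "(T1 Q A \<longleftrightarrow> reports_T1 (pgd Q A \<alpha> z)) \<and> (T2 Q A \<longleftrightarrow> reports_T2 (pgd Q A \<alpha> z)) \<and>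
    (T3 Q A \<longleftrightarrow> reports_T3 (pgd Q A \<alpha> z))"
proof -
  let ?x = "pgd Q A \<alpha> z"
  have excl: "\<not> (reports_T1 ?x \<and> reports_T2 ?x)" "\<not> (reports_T1 ?x \<and> reports_T3 ?x)"
    "\<not> (reports_T2 ?x \<and> reports_T3 ?x)"
    unfolding reports_T1_def reports_T2_def reports_T3_def
    using LIMSEQ_unique not_tendsto_and_filterlim_at_infinity[of sequentially ?x] by auto
  have "T1 Q A \<Longrightarrow> reports_T1 ?x"
    using not_T3_pgd_converges(2)[of z] T_disjoint(2) converges_exp_imp_tendsto[of ?x]
    by (auto simp: reports_T1_def T1_pgd_limit)
  moreover have "T2 Q A \<Longrightarrow> reports_T2 ?x"
  proof -
    assume "T2 Q A"
    then obtain b where b: "b \<in> eigenbasis" "curv b = 0" using T2_eigenvector by blast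
    \<comment> \<open>Genericity enters here: the coordinate along a flat direction passes unchanged
      into the limit.\<close>
    then have "b \<bullet> pgd_limit z \<noteq> 0" using generic by (simp add: inner_pgd_limit)
    then have "pgd_limit z \<noteq> 0" by auto
    moreover have "?x \<longlonglongrightarrow> pgd_limit z"
      using \<open>T2 Q A\<close> T_disjoint(3) not_T3_pgd_converges(2) converges_exp_imp_tendsto by blast
    ultimately show "reports_T2 ?x" by (auto simp: reports_T2_def)
  qed
  moreover have "T3 Q A \<Longrightarrow> reports_T3 ?x"
    using generic pgd_diverges diverges_exp_imp_at_infinity
    unfolding T3_iff reports_T3_def by blast
  ultimately show ?thesis using excl T_cases T_disjoint by blast
qed

end

section \<open>Random initialization\<close>

lemma AE_not_in_hyperplane:
  fixes \<eta>0 :: "'m \<Rightarrow> 'a::euclidean_space"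
  assumes "\<eta>0 \<in> borel_measurable M" "absolutely_continuous lborel (distr M borel \<eta>0)" "w \<noteq> 0"
  shows "AE \<omega> in M. w \<bullet> \<eta>0 \<omega> \<noteq> 0"
proof -
  \<comment> \<open>Negligibility concerns the completed measure; the hyperplane is Borel, so it is
    null for \<open>lborel\<close> as well.\<close>
  have "{z. w \<bullet> z = 0} \<in> null_sets lebesgue"
    using negligible_hyperplane[of w 0] assms(3) by (simp add: negligible_iff_null_sets)
  moreover have borel: "{z. w \<bullet> z = 0} \<in> sets borel"
    using closed_hyperplane by (rule borel_closed)
  ultimately have "{z. w \<bullet> z = 0} \<in> null_sets lborel"
    by (simp add: null_sets_completion_iff)
  then have "{z. w \<bullet> z = 0} \<in> null_sets (distr M borel \<eta>0)"
    using assms(2) by (auto simp: absolutely_continuous_def)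
  then have "AE z in distr M borel \<eta>0. w \<bullet> z \<noteq> 0"
    by (rule AE_I') auto
  then show ?thesis
    using assms(1) borel by (subst (asm) AE_distr_iff) (auto simp: Collect_neg_eq)
qed

text \<open>For arbitrary starts the limit is only claimed to be stationary: the start 0 stays at 0
  even when the objective is unbounded below. Limits are minimizers for every start if a solution
  exists; in general the choice between a minimizer and divergence holds almost surely.\<close>

theorem lemma3:
  fixes Q :: "real^'p^'p" and A :: "real^'p^'q" and \<alpha> :: real
    and M :: "'m measure" and \<eta>0 :: "'m \<Rightarrow> real^'p"
  assumes "transpose Q = Q"
    and "rank A = CARD('q)"
    and "0 < \<alpha>"
    and "lambda_max Q > 0 \<longrightarrow> \<alpha> < 1 / lambda_max Q"
    and "prob_space M"
    and "\<eta>0 \<in> borel_measurable M"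
    and "absolutely_continuous lborel (distr M borel \<eta>0)"
  shows "(\<forall>z. (\<exists>s. is_stationary Q A s \<and> converges_exp (pgd Q A \<alpha> z) s) \<or>
              diverges_exp (pgd Q A \<alpha> z)) \<and>
         ((\<exists>s. is_solution Q A s) \<longrightarrow>
           (\<forall>z. \<exists>s. is_solution Q A s \<and> converges_exp (pgd Q A \<alpha> z) s)) \<and>
         (AE \<omega> in M. (\<exists>s. is_solution Q A s \<and> converges_exp (pgd Q A \<alpha> (\<eta>0 \<omega>)) s) \<or>
                     diverges_exp (pgd Q A \<alpha> (\<eta>0 \<omega>))) \<and>
         (AE \<omega> in M. (T1 Q A \<longleftrightarrow> reports_T1 (pgd Q A \<alpha> (\<eta>0 \<omega>))) \<and>
                     (T2 Q A \<longleftrightarrow> reports_T2 (pgd Q A \<alpha> (\<eta>0 \<omega>))) \<and>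
                     (T3 Q A \<longleftrightarrow> reports_T3 (pgd Q A \<alpha> (\<eta>0 \<omega>))))"
proof -
  interpret pgd_problem Q A \<alpha> by unfold_locales fact+
  \<comment> \<open>The start avoids finitely many hyperplanes, each of probability zero.\<close>
  have generic: "AE \<omega> in M. \<forall>b\<in>eigenbasis. dual b \<bullet> \<eta>0 \<omega> \<noteq> 0"
    using AE_not_in_hyperplane[OF assms(6,7) dual_nonzero] finite_eigenbasis
    by (intro AE_finite_allI) auto
  have "(\<exists>s. is_stationary Q A s \<and> converges_exp (pgd Q A \<alpha> z) s) \<or>
      diverges_exp (pgd Q A \<alpha> z)" for z
    using pgd_diverges pgd_converges is_stationary_pgd_limit by blast
  moreover have "\<exists>s. is_solution Q A s \<and> converges_exp (pgd Q A \<alpha> z) s" if "\<not> T3 Q A" for z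
    using not_T3_pgd_converges[OF that] by blast
  moreover have "AE \<omega> in M. (\<exists>s. is_solution Q A s \<and> converges_exp (pgd Q A \<alpha> (\<eta>0 \<omega>)) s) \<or>
      diverges_exp (pgd Q A \<alpha> (\<eta>0 \<omega>))"
    using generic
  proof eventually_elim
    case (elim \<omega>)
    then show ?case using T3_iff pgd_diverges not_T3_pgd_converges by blast
  qed
  moreover have "AE \<omega> in M. (T1 Q A \<longleftrightarrow> reports_T1 (pgd Q A \<alpha> (\<eta>0 \<omega>))) \<and>
      (T2 Q A \<longleftrightarrow> reports_T2 (pgd Q A \<alpha> (\<eta>0 \<omega>))) \<and>
      (T3 Q A \<longleftrightarrow> reports_T3 (pgd Q A \<alpha> (\<eta>0 \<omega>)))"
    using generic by eventually_elim (rule pgd_reports, blast)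
  \<comment> \<open>Existence of a solution excludes \<open>T3\<close>, which turns the conditional
    convergence above into the second claim.\<close>
  ultimately show ?thesis using is_solution_imp_not_T3 by blast
qed

end
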